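(* Let $O$ be a clone, $M$ a set and $\mathcal{A}$ an infinitesimal $O$-atlas for $M$. Then the forgetful functor $U:O\text{-}\mathbf{iAlg}\to\mathbf{Set}$ lifts the union of $\mathcal{A}$ uniquely; that is, there is a unique colimiting cocone $\mu$ in $O\text{-}\mathbf{iAlg}$ of the lifted diagram $\mathcal{A}\to O\text{-}\mathbf{iAlg}$ such that $U\mu$ is the cocone of subset inclusions $V\hookrightarrow M$, $V\in\mathcal{A}$.
   Context: A clone $O$ consists of sets $O(n)$ for $n\in\mathbb{N}$, maps $\ast_{nk}:O(n)\times O(k)^n\to O(k)$ for all $n,k\in\mathbb{N}$, and elements $\pi^n_j\in O(n)$ for $n\ge 1$, $1\le j\le n$, such that: (associativity) $\sigma\ast_{nk}(t_1\ast_{mk}\vec s,\ldots,t_n\ast_{mk}\vec s)=(\sigma\ast_{nm}(t_1,\ldots,t_n))\ast_{mk}\vec s$ for $\sigma\in O(n)$, $t_i\in O(m)$, $\vec s\in O(k)^m$; (projection) $\pi^n_j\ast_{nm}(t_1,\ldots,t_n)=t_j$; (unit) $\sigma\ast_{nn}(\pi^n_1,\ldots,\pi^n_n)=\sigma$ for $n\geq 1$; (normalisation) $\ast_{00}(c)=c$. An i-structure on a set $A$ is a family of subsets $A\langle n\rangle\subseteq A^n$, $n\in\mathbb{N}$, with $A\langle 1\rangle=A$, $A\langle 0\rangle=A^0=1$, and such that for every map $h:m\to n$ of finite sets and $(P_1,\ldots,P_n)\in A\langle n\rangle$ we have $(P_{h(1)},\ldots,P_{h(m)})\in A\langle m\rangle$.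 One writes $\langle P_1,\ldots,P_n\rangle$ for an $n$-tuple in $A\langle n\rangle$. An i-morphism $f:A\to X$ is a map with $f^n(A\langle n\rangle)\subseteq X\langle n\rangle$ for all $n$. It reflects i-structure if $\langle f(x_1),\ldots,f(x_n)\rangle\in X\langle n\rangle$ implies $\langle x_1,\ldots,x_n\rangle\in A\langle n\rangle$, for all $n$. An infinitesimal $O$-algebra (i-$O$-algebra) is a set $A$ with an i-structure and maps $\bullet_n:O(n)\times A\langle n\rangle\to A$, $n\in\mathbb{N}$, such that: (neighbourhood) for $n\ge 1$, $m\in\mathbb{N}$, $\sigma_1,\ldots,\sigma_n\in O(m)$ and $a\in A\langle m\rangle$, $(\sigma_1\bullet_m a,\ldots,\sigma_n\bullet_m a)\in A\langle n\rangle$; (associativity) $\sigma\bullet_n(t_1\bullet_m a,\ldots,t_n\bullet_m a)=(\sigma\ast_{nm}(t_1,\ldots,t_n))\bullet_m a$ for $\sigma\in O(n)$, $t_i\in O(m)$, $a\in A\langle m\rangle$; (projection) $\pi^n_j\bullet_n(a_1,\ldots,a_n)=a_j$ for $n\ge 1$, $1\le j\le n$, $\langle a_1,\ldots,a_n\rangle\in A\langle n\rangle$. An i-$O$-homomorphism is an i-morphism $h$ with $h(\sigma\bullet_n x)=\sigma\bullet_n h^n(x)$ for all $\sigma\in O(n)$, $x\in A\langle n\rangle$; it reflects i-structure if the underlying i-morphism does. These form the category $O\text{-}\mathbf{iAlg}$, and $U$ sends an i-$O$-algebra to its underlying set. Let $M$ be a set and $\operatorname{Sub}(M)$ its poset of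 subsets. A poset $\mathcal{A}\subset\operatorname{Sub}(M)$ together with a lift of $\mathcal{A}$ along $U$ (i.e. a functor $\mathcal{A}\to O\text{-}\mathbf{iAlg}$ whose composite with $U$ sends each $V\in\mathcal{A}$ to $V$ and each relation $V\subseteq V'$ to the inclusion map) is an infinitesimal $O$-atlas for $M$ if (1) $\mathcal{A}$ is stable under finite meets; (2) each i-$O$-monomorphism in the $U$-lift is i-structure reflecting; (3) the union of $\mathcal{A}$ is $M$. *)

theory Defs
  imports Main "HOL-Library.FuncSet"
begin

text \<open>
  Elements of a power \<open>A\<^sup>n\<close> are lists of length \<open>n\<close>; positions are counted from 0, so the
  projection \<open>\<pi>\<^sup>n\<^sub>j\<close> (\<open>1 \<le> j \<le> n\<close>) is \<open>proj \<O> n (j - 1)\<close>. Maps between sets are the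
  extensional functions of \<open>HOL-Library.FuncSet\<close>, so that equality in HOL of maps, algebras
  and cocones is equality of the mathematical objects.
\<close>

definition tuples :: "'a set \<Rightarrow> nat \<Rightarrow> 'a list set" where
  "tuples A n = {xs. length xs = n \<and> set xs \<subseteq> A}"

abbreviation incl :: "'a set \<Rightarrow> 'a \<Rightarrow> 'a" where
  "incl V \<equiv> (\<lambda>x\<in>V. x)"

record 'o clone =
  ops :: "nat \<Rightarrow> 'o set"
  star :: "nat \<Rightarrow> nat \<Rightarrow> 'o \<times> 'o list \<Rightarrow> 'o"
  proj :: "nat \<Rightarrow> nat \<Rightarrow> 'o"

definition is_clone :: "'o clone \<Rightarrow> bool" where
  "is_clone \<O> \<longleftrightarrow>
     (\<forall>n k. star \<O> n k \<in> ops \<O> n \<times> tuples (ops \<O> k) n \<rightarrow> ops \<O> k) \<and>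
     (\<forall>n. \<forall>j<n. proj \<O> n j \<in> ops \<O> n) \<and>
     (\<forall>n m k. \<forall>\<sigma>\<in>ops \<O> n. \<forall>ts\<in>tuples (ops \<O> m) n. \<forall>ss\<in>tuples (ops \<O> k) m.
        star \<O> n k (\<sigma>, map (\<lambda>t. star \<O> m k (t, ss)) ts) = star \<O> m k (star \<O> n m (\<sigma>, ts), ss)) \<and>
     (\<forall>n m. \<forall>j<n. \<forall>ts\<in>tuples (ops \<O> m) n. star \<O> n m (proj \<O> n j, ts) = ts ! j) \<and>
     (\<forall>n\<ge>1. \<forall>\<sigma>\<in>ops \<O> n. star \<O> n n (\<sigma>, map (proj \<O> n) [0..<n]) = \<sigma>) \<and>
     (\<forall>c\<in>ops \<O> 0. star \<O> 0 0 (c, []) = c)"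

definition is_istructure :: "'a set \<Rightarrow> (nat \<Rightarrow> 'a list set) \<Rightarrow> bool" where
  "is_istructure A S \<longleftrightarrow>
     (\<forall>n. S n \<subseteq> tuples A n) \<and>
     S 1 = tuples A 1 \<and>
     S 0 = tuples A 0 \<and>
     (\<forall>m n h. h \<in> {..<m} \<rightarrow> {..<n} \<longrightarrow> (\<forall>P\<in>S n. map (\<lambda>i. P ! h i) [0..<m] \<in> S m))"

definition imorphism ::
  "'a set \<Rightarrow> (nat \<Rightarrow> 'a list set) \<Rightarrow> 'b set \<Rightarrow> (nat \<Rightarrow> 'b list set) \<Rightarrow> ('a \<Rightarrow> 'b) \<Rightarrow> bool" where
  "imorphism A S X T f \<longleftrightarrow> f \<in> A \<rightarrow>\<^sub>E X \<and> (\<forall>n. \<forall>xs\<in>S n. map f xs \<in> T n)"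

definition reflects_istructure ::
  "'a set \<Rightarrow> (nat \<Rightarrow> 'a list set) \<Rightarrow> (nat \<Rightarrow> 'b list set) \<Rightarrow> ('a \<Rightarrow> 'b) \<Rightarrow> bool" where
  "reflects_istructure A S T f \<longleftrightarrow> (\<forall>n. \<forall>xs\<in>tuples A n. map f xs \<in> T n \<longrightarrow> xs \<in> S n)"

record ('o, 'a) ialg =
  carrier :: "'a set"
  istr :: "nat \<Rightarrow> 'a list set"
  act :: "nat \<Rightarrow> 'o \<times> 'a list \<Rightarrow> 'a"

definition is_ialg :: "'o clone \<Rightarrow> ('o, 'a) ialg \<Rightarrow> bool" where
  "is_ialg \<O> A \<longleftrightarrow>
     is_istructure (carrier A) (istr A) \<and>
     (\<forall>n. act A n \<in> ops \<O> n \<times> istr A n \<rightarrow>\<^sub>E carrier A) \<and>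
     (\<forall>n\<ge>1. \<forall>m. \<forall>\<sigma>s\<in>tuples (ops \<O> m) n. \<forall>a\<in>istr A m.
        map (\<lambda>\<sigma>. act A m (\<sigma>, a)) \<sigma>s \<in> istr A n) \<and>
     (\<forall>n m. \<forall>\<sigma>\<in>ops \<O> n. \<forall>ts\<in>tuples (ops \<O> m) n. \<forall>a\<in>istr A m.
        act A n (\<sigma>, map (\<lambda>t. act A m (t, a)) ts) = act A m (star \<O> n m (\<sigma>, ts), a)) \<and>
     (\<forall>n. \<forall>j<n. \<forall>a\<in>istr A n. act A n (proj \<O> n j, a) = a ! j)"

definition ihom :: "'o clone \<Rightarrow> ('o, 'a) ialg \<Rightarrow> ('o, 'b) ialg \<Rightarrow> ('a \<Rightarrow> 'b) set" where
  "ihom \<O> A B = {h. imorphism (carrier A) (istr A) (carrier B) (istr B) h \<and>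
     (\<forall>n. \<forall>\<sigma>\<in>ops \<O> n. \<forall>x\<in>istr A n. h (act A n (\<sigma>, x)) = act B n (\<sigma>, map h x))}"

text \<open>
  Cancellation is tested on algebras over the same element type. Injective homomorphisms, in
  particular inclusions, are cancellable against algebras over any type.
\<close>

definition imono :: "'o clone \<Rightarrow> ('o, 'a) ialg \<Rightarrow> ('o, 'a) ialg \<Rightarrow> ('a \<Rightarrow> 'a) \<Rightarrow> bool" where
  "imono \<O> A B f \<longleftrightarrow> f \<in> ihom \<O> A B \<and>
     (\<forall>X :: ('o, 'a) ialg. is_ialg \<O> X \<longrightarrow> (\<forall>g\<in>ihom \<O> X A. \<forall>g'\<in>ihom \<O> X A.
        compose (carrier X) f g = compose (carrier X) f g' \<longrightarrow> g = g'))"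

text \<open>
  A diagram on the poset \<open>\<A>\<close> (ordered by inclusion) has an object part \<open>D\<close> and an arrow part
  \<open>F\<close>, where \<open>F V W\<close> is the value at the relation \<open>V \<subseteq> W\<close>.
\<close>

definition is_diagram ::
  "'o clone \<Rightarrow> 'a set set \<Rightarrow> ('a set \<Rightarrow> ('o, 'b) ialg) \<Rightarrow> ('a set \<Rightarrow> 'a set \<Rightarrow> 'b \<Rightarrow> 'b) \<Rightarrow> bool" where
  "is_diagram \<O> \<A> D F \<longleftrightarrow>
     (\<forall>V\<in>\<A>. is_ialg \<O> (D V)) \<and>
     (\<forall>V\<in>\<A>. \<forall>W\<in>\<A>. V \<subseteq> W \<longrightarrow> F V W \<in> ihom \<O> (D V) (D W)) \<and>
     (\<forall>V\<in>\<A>. F V V = incl (carrier (D V))) \<and>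
     (\<forall>V\<in>\<A>. \<forall>W\<in>\<A>. \<forall>Z\<in>\<A>. V \<subseteq> W \<longrightarrow> W \<subseteq> Z \<longrightarrow>
        F V Z = compose (carrier (D V)) (F W Z) (F V W))"

definition is_U_lift ::
  "'o clone \<Rightarrow> 'a set set \<Rightarrow> ('a set \<Rightarrow> ('o, 'a) ialg) \<Rightarrow> ('a set \<Rightarrow> 'a set \<Rightarrow> 'a \<Rightarrow> 'a) \<Rightarrow> bool" where
  "is_U_lift \<O> \<A> D F \<longleftrightarrow>
     is_diagram \<O> \<A> D F \<and>
     (\<forall>V\<in>\<A>. carrier (D V) = V) \<and>
     (\<forall>V\<in>\<A>. \<forall>W\<in>\<A>. V \<subseteq> W \<longrightarrow> F V W = incl V)"

text \<open>
  Stability under finite meets is required for nonempty finite meets only: the empty meet in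
  the poset of subsets of \<open>M\<close> is \<open>M\<close>, and an atlas need not contain \<open>M\<close>.
\<close>

definition is_atlas ::
  "'o clone \<Rightarrow> 'a set \<Rightarrow> 'a set set \<Rightarrow> ('a set \<Rightarrow> ('o, 'a) ialg) \<Rightarrow>
   ('a set \<Rightarrow> 'a set \<Rightarrow> 'a \<Rightarrow> 'a) \<Rightarrow> bool" where
  "is_atlas \<O> M \<A> D F \<longleftrightarrow>
     \<A> \<subseteq> Pow M \<and>
     is_U_lift \<O> \<A> D F \<and>
     (\<forall>\<F>. \<F> \<subseteq> \<A> \<and> finite \<F> \<and> \<F> \<noteq> {} \<longrightarrow> \<Inter>\<F> \<in> \<A>) \<and>
     (\<forall>V\<in>\<A>. \<forall>W\<in>\<A>. V \<subseteq> W \<longrightarrow> imono \<O> (D V) (D W) (F V W) \<longrightarrow>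
        reflects_istructure (carrier (D V)) (istr (D V)) (istr (D W)) (F V W)) \<and>
     \<Union>\<A> = M"

text \<open>A cocone is a pair of its vertex and its family of legs.\<close>

type_synonym ('o, 'a, 'b, 'x) cocone = "('o, 'x) ialg \<times> ('a set \<Rightarrow> 'b \<Rightarrow> 'x)"

definition is_cocone ::
  "'o clone \<Rightarrow> 'a set set \<Rightarrow> ('a set \<Rightarrow> ('o, 'b) ialg) \<Rightarrow> ('a set \<Rightarrow> 'a set \<Rightarrow> 'b \<Rightarrow> 'b) \<Rightarrow>
   ('o, 'a, 'b, 'x) cocone \<Rightarrow> bool" where
  "is_cocone \<O> \<A> D F \<mu> \<longleftrightarrow>
     is_ialg \<O> (fst \<mu>) \<and>
     snd \<mu> \<in> (\<Pi>\<^sub>E V\<in>\<A>. ihom \<O> (D V) (fst \<mu>)) \<and>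
     (\<forall>V\<in>\<A>. \<forall>W\<in>\<A>. V \<subseteq> W \<longrightarrow> compose (carrier (D V)) (snd \<mu> W) (F V W) = snd \<mu> V)"

text \<open>
  HOL cannot quantify over types inside a formula, so the element type \<open>'x\<close> of the algebras
  against which the universal property is tested is a parameter.
\<close>

definition is_colimiting ::
  "'x itself \<Rightarrow> 'o clone \<Rightarrow> 'a set set \<Rightarrow> ('a set \<Rightarrow> ('o, 'b) ialg) \<Rightarrow>
   ('a set \<Rightarrow> 'a set \<Rightarrow> 'b \<Rightarrow> 'b) \<Rightarrow> ('o, 'a, 'b, 'c) cocone \<Rightarrow> bool" where
  "is_colimiting _ \<O> \<A> D F \<mu> \<longleftrightarrow>
     is_cocone \<O> \<A> D F \<mu> \<and>
     (\<forall>\<nu> :: ('o, 'a, 'b, 'x) cocone. is_cocone \<O> \<A> D F \<nu> \<longrightarrow>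
        (\<exists>!h. h \<in> ihom \<O> (fst \<mu>) (fst \<nu>) \<and>
              (\<forall>V\<in>\<A>. compose (carrier (D V)) h (snd \<mu> V) = snd \<nu> V)))"

definition U_cocone ::
  "('o, 'a, 'b, 'x) cocone \<Rightarrow> 'x set \<times> ('a set \<Rightarrow> 'b \<Rightarrow> 'x)" where
  "U_cocone \<mu> = (carrier (fst \<mu>), snd \<mu>)"

definition inclusion_cocone ::
  "'a set \<Rightarrow> 'a set set \<Rightarrow> 'a set \<times> ('a set \<Rightarrow> 'a \<Rightarrow> 'a)" where
  "inclusion_cocone M \<A> = (M, \<lambda>V\<in>\<A>. incl V)"

end

theory Submission
  imports Defs
begin

text \<open>
  A tuple of \<open>M\<close> is infinitesimal iff it is so in some chart, and the operations act as in that
  chart. If two charts contain a tuple, both inclusions of their intersection reflect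
  i-structure, so the tuple already lies in the intersection and the two actions agree. A cocone
  glues for the same reason. Conversely, the comparison homomorphism between two colimiting
  cocones over the subset inclusions is the identity map, so their algebra structures coincide.
\<close>

section \<open>Elementary consequences of the algebra, clone and cocone axioms\<close>

lemma is_ialgD:
  assumes "is_ialg \<O> A"
  shows "is_istructure (carrier A) (istr A)"
    and "\<forall>n. act A n \<in> ops \<O> n \<times> istr A n \<rightarrow>\<^sub>E carrier A"
    and "\<forall>n\<ge>1. \<forall>m. \<forall>\<sigma>s\<in>tuples (ops \<O> m) n. \<forall>a\<in>istr A m.
      map (\<lambda>\<sigma>. act A m (\<sigma>, a)) \<sigma>s \<in> istr A n"
    and "\<forall>n m. \<forall>\<sigma>\<in>ops \<O> n. \<forall>ts\<in>tuples (ops \<O> m) n. \<forall>a\<in>istr A m.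
      act A n (\<sigma>, map (\<lambda>t. act A m (t, a)) ts) = act A m (star \<O> n m (\<sigma>, ts), a)"
    and "\<forall>n. \<forall>j<n. \<forall>a\<in>istr A n. act A n (proj \<O> n j, a) = a ! j"
  using assms unfolding is_ialg_def by - (elim conjE, assumption)+

lemma is_istructureD:
  assumes "is_istructure A S"
  shows "\<forall>n. S n \<subseteq> tuples A n" and "S 1 = tuples A 1" and "S 0 = tuples A 0"
    and "\<forall>m n h. h \<in> {..<m} \<rightarrow> {..<n} \<longrightarrow> (\<forall>P\<in>S n. map (\<lambda>i. P ! h i) [0..<m] \<in> S m)"
  using assms unfolding is_istructure_def by - (elim conjE, assumption)+

lemma ialg_istr_tuples:
  assumes "is_ialg \<O> A" "xs \<in> istr A n"
  shows "length xs = n" "set xs \<subseteq> carrier A"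
proof -
  have "xs \<in> tuples (carrier A) n"
    using is_istructureD(1)[OF is_ialgD(1)[OF assms(1)]] assms(2) by blast
  then show "length xs = n" "set xs \<subseteq> carrier A" by (simp_all add: tuples_def)
qed

lemma ialg_istr_0: "is_ialg \<O> A \<Longrightarrow> istr A 0 = {[]}"
  using is_istructureD(3)[OF is_ialgD(1)] by (auto simp: tuples_def)

lemma ialg_istr_1: "is_ialg \<O> A \<Longrightarrow> istr A (Suc 0) = tuples (carrier A) (Suc 0)"
  using is_istructureD(2)[OF is_ialgD(1)] by simp

lemma ialg_istr_reindex:
  assumes "is_ialg \<O> A" "h \<in> {..<m} \<rightarrow> {..<n}" "P \<in> istr A n"
  shows "map (\<lambda>i. P ! h i) [0..<m] \<in> istr A m"
  using is_istructureD(4)[OF is_ialgD(1)[OF assms(1)], rule_format, OF assms(2,3)] .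

lemma ialg_act_closed:
  assumes "is_ialg \<O> A" "\<sigma> \<in> ops \<O> n" "xs \<in> istr A n"
  shows "act A n (\<sigma>, xs) \<in> carrier A"
  by (rule PiE_mem[OF is_ialgD(2)[OF assms(1), rule_format]]) (use assms in simp)

text \<open>The axiom covers only \<open>n \<ge> 1\<close>; for \<open>n = 0\<close> the image is
  the empty tuple, which belongs to every i-structure.\<close>

lemma ialg_neighbourhood:
  assumes "is_ialg \<O> A" "\<sigma>s \<in> tuples (ops \<O> m) n" "a \<in> istr A m"
  shows "map (\<lambda>\<sigma>. act A m (\<sigma>, a)) \<sigma>s \<in> istr A n"
proof (cases "n = 0")
  case True
  then show ?thesis using assms ialg_istr_0[OF assms(1)] by (simp add: tuples_def)
next
  case False
  then show ?thesis using is_ialgD(3)[OF assms(1), rule_format, OF _ assms(2,3)] by simp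
qed

lemma ialg_assoc:
  assumes "is_ialg \<O> A" "\<sigma> \<in> ops \<O> n" "ts \<in> tuples (ops \<O> m) n" "a \<in> istr A m"
  shows "act A n (\<sigma>, map (\<lambda>t. act A m (t, a)) ts) = act A m (star \<O> n m (\<sigma>, ts), a)"
  using is_ialgD(4)[OF assms(1), rule_format, OF assms(2-4)] .

lemma ialg_proj:
  assumes "is_ialg \<O> A" "j < n" "a \<in> istr A n"
  shows "act A n (proj \<O> n j, a) = a ! j"
  using is_ialgD(5)[OF assms(1), rule_format, OF assms(2,3)] .

lemma is_cloneD:
  assumes "is_clone \<O>"
  shows "\<forall>n k. star \<O> n k \<in> ops \<O> n \<times> tuples (ops \<O> k) n \<rightarrow> ops \<O> k"
    and "\<forall>n. \<forall>j<n. proj \<O> n j \<in> ops \<O> n"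
  using assms unfolding is_clone_def by - (elim conjE, assumption)+

lemma star_closed:
  assumes "is_clone \<O>" "\<sigma> \<in> ops \<O> n" "ts \<in> tuples (ops \<O> m) n"
  shows "star \<O> n m (\<sigma>, ts) \<in> ops \<O> m"
  by (rule funcset_mem[OF is_cloneD(1)[OF assms(1), rule_format]]) (use assms in simp)

lemma proj_closed: "is_clone \<O> \<Longrightarrow> j < n \<Longrightarrow> proj \<O> n j \<in> ops \<O> n"
  by (rule is_cloneD(2)[rule_format])

lemma is_coconeD:
  assumes "is_cocone \<O> \<A> D F \<mu>"
  shows "is_ialg \<O> (fst \<mu>)"
    and "\<And>V. V \<in> \<A> \<Longrightarrow> snd \<mu> V \<in> ihom \<O> (D V) (fst \<mu>)"
    and "\<And>V W. V \<in> \<A> \<Longrightarrow> W \<in> \<A> \<Longrightarrow> V \<subseteq> W \<Longrightarrow>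
      compose (carrier (D V)) (snd \<mu> W) (F V W) = snd \<mu> V"
  using assms unfolding is_cocone_def by (simp_all add: PiE_iff)

lemma ihom_extensional: "h \<in> ihom \<O> A B \<Longrightarrow> h \<in> carrier A \<rightarrow>\<^sub>E carrier B"
  unfolding ihom_def imorphism_def by blast

lemma ihom_istr: "h \<in> ihom \<O> A B \<Longrightarrow> xs \<in> istr A n \<Longrightarrow> map h xs \<in> istr B n"
  unfolding ihom_def imorphism_def by blast

lemma ihom_act:
  "h \<in> ihom \<O> A B \<Longrightarrow> \<sigma> \<in> ops \<O> n \<Longrightarrow> xs \<in> istr A n \<Longrightarrow>
   h (act A n (\<sigma>, xs)) = act B n (\<sigma>, map h xs)"
  unfolding ihom_def by blast

lemma map_incl: "set xs \<subseteq> V \<Longrightarrow> map (incl V) xs = xs"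
  by (rule map_idI) auto

text \<open>This makes the reflection condition of an atlas, which speaks of monomorphisms,
  available for inclusions of charts. Injectivity cancels pointwise, and extensionality of
  homomorphisms turns pointwise equality into equality.\<close>

lemma injective_ihom_imono:
  fixes A B :: "('o, 'a) ialg"
  assumes f: "f \<in> ihom \<O> A B" and inj: "inj_on f (carrier A)"
  shows "imono \<O> A B f"
  unfolding imono_def
proof (intro conjI ballI allI impI)
  fix X :: "('o, 'a) ialg" and g g'
  assume g: "g \<in> ihom \<O> X A" "g' \<in> ihom \<O> X A"
    and eq: "compose (carrier X) f g = compose (carrier X) f g'"
  note ext = g[THEN ihom_extensional]
  show "g = g'"
  proof (rule PiE_ext[OF ext])
    fix x assume x: "x \<in> carrier X"
    then have "f (g x) = f (g' x)" using fun_cong[OF eq, of x] by (simp add: compose_eq)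
    then show "g x = g' x" using inj x ext by (auto dest: inj_onD)
  qed
qed (rule f)

section \<open>The algebra glued from the charts\<close>

text \<open>The case \<open>n = 0\<close> is separated because the atlas may be empty.\<close>

definition glued_istr :: "'a set set \<Rightarrow> ('a set \<Rightarrow> ('o, 'a) ialg) \<Rightarrow> nat \<Rightarrow> 'a list set" where
  "glued_istr \<A> D n = (if n = 0 then {[]} else (\<Union>V\<in>\<A>. istr (D V) n))"

text \<open>\<open>SOME\<close> picks any chart in which the tuple is infinitesimal; for an atlas
  the choice does not matter by \<open>chart_act_unique\<close>. The restriction makes the action
  extensional, as \<open>is_ialg\<close> demands.\<close>

definition glued_ialg ::
  "'o clone \<Rightarrow> 'a set set \<Rightarrow> ('a set \<Rightarrow> ('o, 'a) ialg) \<Rightarrow> ('o, 'a) ialg" where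
  "glued_ialg \<O> \<A> D =
     \<lparr>carrier = \<Union>\<A>, istr = glued_istr \<A> D,
      act = (\<lambda>n. \<lambda>p\<in>ops \<O> n \<times> glued_istr \<A> D n.
        act (D (SOME V. V \<in> \<A> \<and> snd p \<in> istr (D V) n)) n p)\<rparr>"

lemma glued_ialg_simps [simp]:
  "carrier (glued_ialg \<O> \<A> D) = \<Union>\<A>"
  "istr (glued_ialg \<O> \<A> D) = glued_istr \<A> D"
  by (simp_all add: glued_ialg_def)

text \<open>If \<A> is empty, then so is M, but the empty tuple is still infinitesimal. A constant
  would then have to act with a value in the empty set; \<open>no_constants\<close> excludes
  this.\<close>

locale atlas =
  fixes \<O> :: "'o clone" and M :: "'a set" and \<A> :: "'a set set"
    and D :: "'a set \<Rightarrow> ('o, 'a) ialg" and F :: "'a set \<Rightarrow> 'a set \<Rightarrow> 'a \<Rightarrow> 'a"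
  assumes clone: "is_clone \<O>"
    and atlas: "is_atlas \<O> M \<A> D F"
    and no_constants: "\<A> = {} \<Longrightarrow> ops \<O> 0 = {}"
begin

section \<open>Compatibility of overlapping charts\<close>

lemma is_atlasD:
  shows "is_U_lift \<O> \<A> D F"
    and "\<forall>\<F>. \<F> \<subseteq> \<A> \<and> finite \<F> \<and> \<F> \<noteq> {} \<longrightarrow> \<Inter>\<F> \<in> \<A>"
    and "\<forall>V\<in>\<A>. \<forall>W\<in>\<A>. V \<subseteq> W \<longrightarrow> imono \<O> (D V) (D W) (F V W) \<longrightarrow>
      reflects_istructure (carrier (D V)) (istr (D V)) (istr (D W)) (F V W)"
    and Union_charts: "\<Union>\<A> = M"
  using atlas unfolding is_atlas_def by - (elim conjE, assumption)+

lemma is_U_liftD: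
  shows "\<forall>V\<in>\<A>. is_ialg \<O> (D V)"
    and "\<forall>V\<in>\<A>. \<forall>W\<in>\<A>. V \<subseteq> W \<longrightarrow> F V W \<in> ihom \<O> (D V) (D W)"
    and "\<forall>V\<in>\<A>. carrier (D V) = V"
    and "\<forall>V\<in>\<A>. \<forall>W\<in>\<A>. V \<subseteq> W \<longrightarrow> F V W = incl V"
  using is_atlasD(1) unfolding is_U_lift_def is_diagram_def by - (elim conjE, assumption)+

lemma chart_ialg: "V \<in> \<A> \<Longrightarrow> is_ialg \<O> (D V)"
  using is_U_liftD(1) by blast

lemma chart_carrier: "V \<in> \<A> \<Longrightarrow> carrier (D V) = V"
  using is_U_liftD(3) by blast

lemma chart_arrow: "V \<in> \<A> \<Longrightarrow> W \<in> \<A> \<Longrightarrow> V \<subseteq> W \<Longrightarrow> F V W = incl V"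
  using is_U_liftD(4) by blast

lemma chart_incl_ihom:
  assumes "V \<in> \<A>" "W \<in> \<A>" "V \<subseteq> W"
  shows "incl V \<in> ihom \<O> (D V) (D W)"
  using is_U_liftD(2)[rule_format, OF assms] unfolding chart_arrow[OF assms] .

lemma chart_Int: "V \<in> \<A> \<Longrightarrow> W \<in> \<A> \<Longrightarrow> V \<inter> W \<in> \<A>"
  using is_atlasD(2)[rule_format, of "{V, W}"] by simp

lemma chart_istr_set: "V \<in> \<A> \<Longrightarrow> xs \<in> istr (D V) n \<Longrightarrow> set xs \<subseteq> V"
  using ialg_istr_tuples(2)[OF chart_ialg] chart_carrier by blast

text \<open>The inclusion is injective, hence a monomorphism, hence reflects i-structure by the
  atlas condition; it leaves \<open>xs\<close> unchanged.\<close>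

lemma chart_istr_reflect:
  assumes "V \<in> \<A>" "W \<in> \<A>" "V \<subseteq> W" "xs \<in> istr (D W) n" "set xs \<subseteq> V"
  shows "xs \<in> istr (D V) n"
proof -
  have "imono \<O> (D V) (D W) (incl V)"
    using assms by (intro injective_ihom_imono chart_incl_ihom) (auto simp: inj_on_def chart_carrier)
  then have "reflects_istructure V (istr (D V)) (istr (D W)) (incl V)"
    using is_atlasD(3)[rule_format, OF assms(1-3)]
    unfolding chart_arrow[OF assms(1-3)] chart_carrier[OF assms(1)] by blast
  moreover have "xs \<in> tuples V n"
    using assms ialg_istr_tuples(1)[OF chart_ialg[OF assms(2)]] by (auto simp: tuples_def)
  ultimately show ?thesis
    using assms(4) map_incl[OF assms(5)] unfolding reflects_istructure_def by metis
qed

lemma chart_act_subset: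
  assumes "V \<in> \<A>" "W \<in> \<A>" "V \<subseteq> W" "\<sigma> \<in> ops \<O> n" "xs \<in> istr (D V) n"
  shows "act (D V) n (\<sigma>, xs) = act (D W) n (\<sigma>, xs)"
proof -
  \<comment> \<open>\<open>incl V\<close> is the identity only on V, so the value must be known to
    lie in V before the homomorphism equation can be read as the claim.\<close>
  have "act (D V) n (\<sigma>, xs) \<in> V"
    using ialg_act_closed[OF chart_ialg] chart_carrier assms by blast
  then show ?thesis
    using ihom_act[OF chart_incl_ihom[OF assms(1-3)] assms(4,5)]
      map_incl[OF chart_istr_set[OF assms(1,5)]] by simp
qed

text \<open>V and W need not be comparable, so both actions are compared with that of their
  intersection, where the tuple lies by reflection.\<close>

lemma chart_act_unique:
  assumes "V \<in> \<A>" "W \<in> \<A>" "\<sigma> \<in> ops \<O> n" "xs \<in> istr (D V) n" "xs \<in> istr (D W) n"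
  shows "act (D V) n (\<sigma>, xs) = act (D W) n (\<sigma>, xs)"
proof -
  have VW: "V \<inter> W \<in> \<A>" using assms chart_Int by blast
  have "set xs \<subseteq> V \<inter> W" using chart_istr_set assms by blast
  then have "xs \<in> istr (D (V \<inter> W)) n"
    using chart_istr_reflect[OF VW assms(1) _ assms(4)] by blast
  then show ?thesis
    using chart_act_subset[OF VW assms(1) _ assms(3)] chart_act_subset[OF VW assms(2) _ assms(3)]
    by auto
qed

section \<open>The glued structure satisfies the algebra axioms\<close>

lemma chart_istr_glued: "V \<in> \<A> \<Longrightarrow> xs \<in> istr (D V) n \<Longrightarrow> xs \<in> glued_istr \<A> D n"
  using ialg_istr_0[OF chart_ialg] by (auto simp: glued_istr_def)

lemma glued_istr_cases:
  assumes "xs \<in> glued_istr \<A> D n"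
  obtains V where "V \<in> \<A>" "xs \<in> istr (D V) n" | "\<A> = {}" "n = 0" "xs = []"
proof (cases "n = 0")
  case True
  then have "xs = []" using assms by (simp add: glued_istr_def)
  show thesis
  proof (cases "\<A> = {}")
    case False
    then obtain V where "V \<in> \<A>" by blast
    then show thesis using that(1) ialg_istr_0[OF chart_ialg] \<open>n = 0\<close> \<open>xs = []\<close> by blast
  qed (use that(2) \<open>n = 0\<close> \<open>xs = []\<close> in blast)
next
  case False
  then show thesis using assms that(1) by (auto simp: glued_istr_def)
qed

text \<open>An operation of matching arity rules out the exceptional case of
  \<open>glued_istr_cases\<close>: there it would be a constant over an empty atlas. Every axiom
  involving the action can thus be checked inside one chart.\<close>

lemma glued_istr_op_cases:
  assumes "xs \<in> glued_istr \<A> D n" "\<sigma> \<in> ops \<O> n"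
  obtains V where "V \<in> \<A>" "xs \<in> istr (D V) n"
  using assms(1)
proof (cases rule: glued_istr_cases)
  case 2
  then show thesis using assms(2) no_constants by simp
qed (rule that)

lemma glued_act:
  assumes "V \<in> \<A>" "\<sigma> \<in> ops \<O> n" "xs \<in> istr (D V) n"
  shows "act (glued_ialg \<O> \<A> D) n (\<sigma>, xs) = act (D V) n (\<sigma>, xs)"
proof -
  define W where "W = (SOME W. W \<in> \<A> \<and> xs \<in> istr (D W) n)"
  have "W \<in> \<A> \<and> xs \<in> istr (D W) n"
    unfolding W_def by (rule someI[of _ V]) (use assms in blast)
  then have "act (D W) n (\<sigma>, xs) = act (D V) n (\<sigma>, xs)"
    using assms chart_act_unique by blast
  then show ?thesis
    using assms chart_istr_glued by (simp add: glued_ialg_def W_def)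
qed

text \<open>Each condition concerns a single tuple and is inherited from a chart containing it. All
  1-tuples occur because the charts cover M.\<close>

lemma glued_istructure: "is_istructure M (glued_istr \<A> D)"
  unfolding is_istructure_def
proof (intro conjI allI impI ballI)
  fix n
  show "glued_istr \<A> D n \<subseteq> tuples M n"
  proof
    fix xs assume "xs \<in> glued_istr \<A> D n"
    then show "xs \<in> tuples M n"
    proof (cases rule: glued_istr_cases)
      case (1 V)
      then show ?thesis
        using ialg_istr_tuples(1)[OF chart_ialg] chart_istr_set[OF 1] Union_charts
        by (auto simp: tuples_def)
    qed (simp add: tuples_def)
  qed
next
  show "glued_istr \<A> D 1 = tuples M 1"
    using Union_charts
    by (auto simp: glued_istr_def ialg_istr_1[OF chart_ialg] chart_carrier tuples_def
        length_Suc_conv)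
next
  show "glued_istr \<A> D 0 = tuples M 0" by (auto simp: glued_istr_def tuples_def)
next
  fix m n and h :: "nat \<Rightarrow> nat" and P
  assume h: "h \<in> {..<m} \<rightarrow> {..<n}" and P: "P \<in> glued_istr \<A> D n"
  from P show "map (\<lambda>i. P ! h i) [0..<m] \<in> glued_istr \<A> D m"
  proof (cases rule: glued_istr_cases)
    case (1 V)
    then show ?thesis using chart_istr_glued ialg_istr_reindex[OF chart_ialg h] by blast
  next
    case 2
    \<comment> \<open>Here \<open>n = 0\<close>, so \<open>h\<close> maps into the empty set and its
      domain must be empty.\<close>
    then have "m = 0" using h by (cases m) auto
    then show ?thesis by (simp add: glued_istr_def)
  qed
qed

lemma glued_is_ialg: "is_ialg \<O> (glued_ialg \<O> \<A> D)" (is "is_ialg \<O> ?G")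
  unfolding is_ialg_def glued_ialg_simps
proof (intro conjI allI ballI impI)
  show "is_istructure (\<Union>\<A>) (glued_istr \<A> D)"
    using glued_istructure Union_charts by simp
next
  fix n
  show "act ?G n \<in> ops \<O> n \<times> glued_istr \<A> D n \<rightarrow>\<^sub>E \<Union>\<A>"
  proof (rule PiE_I)
    fix p assume "p \<in> ops \<O> n \<times> glued_istr \<A> D n"
    then obtain \<sigma> xs where p: "p = (\<sigma>, xs)" "\<sigma> \<in> ops \<O> n" "xs \<in> glued_istr \<A> D n" by blast
    obtain V where V: "V \<in> \<A>" "xs \<in> istr (D V) n"
      using glued_istr_op_cases[OF p(3,2)] .
    then have "act (D V) n (\<sigma>, xs) \<in> V"
      using ialg_act_closed[OF chart_ialg] chart_carrier p by blast
    then show "act ?G n p \<in> \<Union>\<A>" using glued_act[OF V(1) p(2) V(2)] V p by auto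
  qed (simp add: glued_ialg_def)
next
  fix n m :: nat and \<sigma>s a
  assume n: "1 \<le> n" and \<sigma>s: "\<sigma>s \<in> tuples (ops \<O> m) n" and a: "a \<in> glued_istr \<A> D m"
  \<comment> \<open>Since \<open>n \<ge> 1\<close>, the list supplies an operation of arity
    \<open>m\<close>, which is what locates a chart for \<open>a\<close>.\<close>
  have "hd \<sigma>s \<in> ops \<O> m" using n \<sigma>s by (cases \<sigma>s) (auto simp: tuples_def)
  then obtain V where V: "V \<in> \<A>" "a \<in> istr (D V) m"
    using glued_istr_op_cases[OF a] by blast
  have eq: "map (\<lambda>\<sigma>. act ?G m (\<sigma>, a)) \<sigma>s = map (\<lambda>\<sigma>. act (D V) m (\<sigma>, a)) \<sigma>s"
    using \<sigma>s glued_act[OF V(1) _ V(2)] by (auto simp: tuples_def)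
  show "map (\<lambda>\<sigma>. act ?G m (\<sigma>, a)) \<sigma>s \<in> glued_istr \<A> D n"
    unfolding eq
    using chart_istr_glued[OF V(1) ialg_neighbourhood[OF chart_ialg[OF V(1)] \<sigma>s V(2)]] .
next
  fix n m \<sigma> ts a
  assume \<sigma>: "\<sigma> \<in> ops \<O> n" and ts: "ts \<in> tuples (ops \<O> m) n" and a: "a \<in> glued_istr \<A> D m"
  \<comment> \<open>The composite has the arity \<open>m\<close> of \<open>a\<close> and so locates
    a chart even for \<open>n = 0\<close>, when \<open>ts\<close> is empty.\<close>
  have st: "star \<O> n m (\<sigma>, ts) \<in> ops \<O> m" using star_closed[OF clone \<sigma> ts] .
  obtain V where V: "V \<in> \<A>" "a \<in> istr (D V) m"
    using glued_istr_op_cases[OF a st] .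
  have eq: "map (\<lambda>t. act ?G m (t, a)) ts = map (\<lambda>t. act (D V) m (t, a)) ts"
    using ts glued_act[OF V(1) _ V(2)] by (auto simp: tuples_def)
  \<comment> \<open>By the neighbourhood axiom in V the inner values form an infinitesimal tuple of
    V, so the outer operation is computed in the same chart.\<close>
  show "act ?G n (\<sigma>, map (\<lambda>t. act ?G m (t, a)) ts) = act ?G m (star \<O> n m (\<sigma>, ts), a)"
    unfolding eq glued_act[OF V(1) st V(2)]
      glued_act[OF V(1) \<sigma> ialg_neighbourhood[OF chart_ialg[OF V(1)] ts V(2)]]
    using ialg_assoc[OF chart_ialg[OF V(1)] \<sigma> ts V(2)] .
next
  fix n j a
  assume j: "j < n" and a: "a \<in> glued_istr \<A> D n"
  have pr: "proj \<O> n j \<in> ops \<O> n" using proj_closed[OF clone j] .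
  obtain V where V: "V \<in> \<A>" "a \<in> istr (D V) n"
    using glued_istr_op_cases[OF a pr] .
  show "act ?G n (proj \<O> n j, a) = a ! j"
    using glued_act[OF V(1) pr V(2)] ialg_proj[OF chart_ialg[OF V(1)] j V(2)] by simp
qed

section \<open>The glued cocone and its universal property\<close>

definition glued_cocone :: "('o, 'a, 'a, 'a) cocone" where
  "glued_cocone = (glued_ialg \<O> \<A> D, \<lambda>V\<in>\<A>. incl V)"

lemma glued_cocone_is_cocone: "is_cocone \<O> \<A> D F glued_cocone"
proof -
  have leg: "incl V \<in> ihom \<O> (D V) (glued_ialg \<O> \<A> D)" if V: "V \<in> \<A>" for V
    unfolding ihom_def imorphism_def mem_Collect_eq glued_ialg_simps
  proof (intro conjI allI ballI)
    show "incl V \<in> carrier (D V) \<rightarrow>\<^sub>E \<Union>\<A>" using V chart_carrier[OF V] by auto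
  next
    fix n xs assume "xs \<in> istr (D V) n"
    then show "map (incl V) xs \<in> glued_istr \<A> D n"
      using chart_istr_glued[OF V] map_incl[OF chart_istr_set[OF V]] by simp
  next
    fix n \<sigma> xs assume *: "\<sigma> \<in> ops \<O> n" "xs \<in> istr (D V) n"
    then show "incl V (act (D V) n (\<sigma>, xs)) = act (glued_ialg \<O> \<A> D) n (\<sigma>, map (incl V) xs)"
      using glued_act[OF V *] map_incl[OF chart_istr_set[OF V *(2)]]
        ialg_act_closed[OF chart_ialg[OF V] *] chart_carrier[OF V] by simp
  qed
  show ?thesis
    unfolding is_cocone_def glued_cocone_def fst_conv snd_conv
  proof (intro conjI ballI impI)
    show "(\<lambda>V\<in>\<A>. incl V) \<in> (\<Pi>\<^sub>E V\<in>\<A>. ihom \<O> (D V) (glued_ialg \<O> \<A> D))"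
      using leg by (intro restrict_PiE_iff[THEN iffD2]) blast
  next
    fix V W assume VW: "V \<in> \<A>" "W \<in> \<A>" "V \<subseteq> W"
    show "compose (carrier (D V)) ((\<lambda>V\<in>\<A>. incl V) W) (F V W) = (\<lambda>V\<in>\<A>. incl V) V"
      using VW chart_carrier[OF VW(1)] chart_arrow[OF VW] by (auto simp: compose_def fun_eq_iff)
  qed (rule glued_is_ialg)
qed

text \<open>Both legs restrict to the leg at the intersection of V and W, which is a chart
  containing \<open>x\<close>.\<close>

lemma cocone_legs_agree:
  assumes \<nu>: "is_cocone \<O> \<A> D F \<nu>" and V: "V \<in> \<A>" "x \<in> V" and W: "W \<in> \<A>" "x \<in> W"
  shows "snd \<nu> V x = snd \<nu> W x"
proof -
  have restr: "snd \<nu> Z x = snd \<nu> (V \<inter> W) x" if Z: "Z \<in> \<A>" "V \<inter> W \<subseteq> Z" for Z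
  proof -
    have VW: "V \<inter> W \<in> \<A>" using chart_Int V W by blast
    have "compose (carrier (D (V \<inter> W))) (snd \<nu> Z) (F (V \<inter> W) Z) = snd \<nu> (V \<inter> W)"
      using is_coconeD(3)[OF \<nu> VW Z] .
    from fun_cong[OF this, of x] show ?thesis
      using V W chart_arrow[OF VW Z] chart_carrier[OF VW] by (simp add: compose_eq)
  qed
  show ?thesis using restr[OF V(1)] restr[OF W(1)] by simp
qed

text \<open>The legs of a cocone glue to a map on M, and an infinitesimal tuple lies in one chart,
  where this map is a leg. The type of the test algebras is arbitrary.\<close>

lemma glued_cocone_colimiting: "is_colimiting TYPE('x) \<O> \<A> D F glued_cocone"
  unfolding is_colimiting_def
proof (intro conjI allI impI)
  fix \<nu> :: "('o, 'a, 'a, 'x) cocone"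
  assume \<nu>: "is_cocone \<O> \<A> D F \<nu>"
  let ?N = "fst \<nu>" and ?G = "glued_ialg \<O> \<A> D"
  have N: "is_ialg \<O> ?N" by (rule is_coconeD(1)[OF \<nu>])
  have leg: "snd \<nu> V \<in> ihom \<O> (D V) ?N" if "V \<in> \<A>" for V
    using is_coconeD(2)[OF \<nu> that] .
  \<comment> \<open>Any chart around \<open>x\<close> gives the same value; \<open>h_eq\<close> then
    eliminates the choice.\<close>
  define h where "h = (\<lambda>x\<in>M. snd \<nu> (SOME V. V \<in> \<A> \<and> x \<in> V) x)"
  have h_eq: "h x = snd \<nu> V x" if "V \<in> \<A>" "x \<in> V" for V x
  proof -
    have "(SOME V. V \<in> \<A> \<and> x \<in> V) \<in> \<A> \<and> x \<in> (SOME V. V \<in> \<A> \<and> x \<in> V)"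
      by (rule someI[of _ V]) (use that in blast)
    then have "snd \<nu> (SOME V. V \<in> \<A> \<and> x \<in> V) x = snd \<nu> V x"
      using cocone_legs_agree[OF \<nu>] that by blast
    moreover have "x \<in> M" using that Union_charts by blast
    ultimately show ?thesis by (simp add: h_def)
  qed
  have map_h: "map h xs = map (snd \<nu> V) xs" if "V \<in> \<A>" "xs \<in> istr (D V) n" for V xs n
    using h_eq[OF that(1)] chart_istr_set[OF that] by auto
  have h_ihom: "h \<in> ihom \<O> ?G ?N"
    unfolding ihom_def imorphism_def mem_Collect_eq glued_ialg_simps
  proof (intro conjI allI ballI)
    show "h \<in> \<Union>\<A> \<rightarrow>\<^sub>E carrier ?N"
    proof (rule PiE_I)
      fix x assume "x \<in> \<Union>\<A>"
      then obtain V where V: "V \<in> \<A>" "x \<in> V" by blast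
      then show "h x \<in> carrier ?N"
        using h_eq[OF V] ihom_extensional[OF leg[OF V(1)]] chart_carrier[OF V(1)] by auto
    qed (simp add: h_def Union_charts)
  next
    fix n xs assume "xs \<in> glued_istr \<A> D n"
    then show "map h xs \<in> istr ?N n"
    proof (cases rule: glued_istr_cases)
      case (1 V)
      then show ?thesis using ihom_istr[OF leg] map_h by metis
    next
      case 2
      \<comment> \<open>Over an empty atlas only the empty tuple remains, and it is infinitesimal in
        every algebra.\<close>
      then show ?thesis using ialg_istr_0[OF N] by simp
    qed
  next
    fix n \<sigma> xs assume \<sigma>: "\<sigma> \<in> ops \<O> n" and xs: "xs \<in> glued_istr \<A> D n"
    obtain V where V: "V \<in> \<A>" "xs \<in> istr (D V) n"
      using glued_istr_op_cases[OF xs \<sigma>] .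
    \<comment> \<open>The value stays in V, so \<open>h\<close> is given by the leg at V on the
      arguments and on the value alike.\<close>
    have "act (D V) n (\<sigma>, xs) \<in> V"
      using ialg_act_closed[OF chart_ialg[OF V(1)] \<sigma> V(2)] chart_carrier[OF V(1)] by simp
    then show "h (act ?G n (\<sigma>, xs)) = act ?N n (\<sigma>, map h xs)"
      unfolding map_h[OF V] glued_act[OF V(1) \<sigma> V(2)]
      using h_eq[OF V(1)] ihom_act[OF leg[OF V(1)] \<sigma> V(2)] by simp
  qed
  show "\<exists>!h. h \<in> ihom \<O> (fst glued_cocone) ?N \<and>
      (\<forall>V\<in>\<A>. compose (carrier (D V)) h (snd glued_cocone V) = snd \<nu> V)"
    unfolding glued_cocone_def fst_conv snd_conv
  proof (intro ex1I[of _ h] conjI ballI)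
    fix V assume V: "V \<in> \<A>"
    show "compose (carrier (D V)) h ((\<lambda>V\<in>\<A>. incl V) V) = snd \<nu> V"
      unfolding chart_carrier[OF V]
    proof (rule extensionalityI[OF compose_extensional])
      show "snd \<nu> V \<in> extensional V"
        using ihom_extensional[OF leg[OF V]] chart_carrier[OF V] by (simp add: PiE_iff)
      fix x assume "x \<in> V"
      then show "compose V h ((\<lambda>V\<in>\<A>. incl V) V) x = snd \<nu> V x"
        using V h_eq[OF V] by (simp add: compose_eq)
    qed
  next
    fix g assume g: "g \<in> ihom \<O> ?G ?N \<and>
      (\<forall>V\<in>\<A>. compose (carrier (D V)) g ((\<lambda>V\<in>\<A>. incl V) V) = snd \<nu> V)"
    show "g = h"
    proof (rule PiE_ext[OF ihom_extensional ihom_extensional[OF h_ihom]])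
      fix x assume "x \<in> carrier ?G"
      \<comment> \<open>The charts cover M, so the cocone equation at a chart around
        \<open>x\<close> forces the value of \<open>g\<close>.\<close>
      then obtain V where V: "V \<in> \<A>" "x \<in> V" by auto
      have "compose (carrier (D V)) g ((\<lambda>V\<in>\<A>. incl V) V) x = snd \<nu> V x"
        using g V by simp
      then show "g x = h x"
        using V h_eq[OF V] chart_carrier[OF V(1)] by (simp add: compose_eq)
    qed (use g in blast)
  qed (rule h_ihom)
qed (rule glued_cocone_is_cocone)

lemma U_glued_cocone: "U_cocone glued_cocone = inclusion_cocone M \<A>"
  by (simp add: U_cocone_def glued_cocone_def inclusion_cocone_def Union_charts)

section \<open>Uniqueness of the lifted cocone\<close>

text \<open>The legs of both cocones are inclusions, so the mediating homomorphism fixes every point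
  of every chart, hence of M.\<close>

lemma colimiting_identity_ihom:
  fixes \<mu> \<nu> :: "('o, 'a, 'a, 'a) cocone"
  assumes \<mu>: "is_colimiting TYPE('a) \<O> \<A> D F \<mu>" "U_cocone \<mu> = inclusion_cocone M \<A>"
    and \<nu>: "is_cocone \<O> \<A> D F \<nu>" "U_cocone \<nu> = inclusion_cocone M \<A>"
  shows "incl M \<in> ihom \<O> (fst \<mu>) (fst \<nu>)"
proof -
  obtain h where h: "h \<in> ihom \<O> (fst \<mu>) (fst \<nu>)"
      "\<And>V. V \<in> \<A> \<Longrightarrow> compose (carrier (D V)) h (snd \<mu> V) = snd \<nu> V"
    using \<mu>(1) \<nu>(1) unfolding is_colimiting_def by metis
  have carrier: "carrier (fst \<mu>) = M"
    and legs: "snd \<mu> = (\<lambda>V\<in>\<A>. incl V)" "snd \<nu> = (\<lambda>V\<in>\<A>. incl V)"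
    using \<mu>(2) \<nu>(2) by (simp_all add: U_cocone_def inclusion_cocone_def)
  have "h = incl M"
  proof (rule extensionalityI)
    show "h \<in> extensional M" using ihom_extensional[OF h(1)] carrier by (simp add: PiE_iff)
    fix x assume x: "x \<in> M"
    then obtain V where V: "V \<in> \<A>" "x \<in> V" using Union_charts by blast
    from fun_cong[OF h(2)[OF V(1)], of x] show "h x = incl M x"
      using V x chart_carrier[OF V(1)] by (simp add: legs compose_eq)
  qed simp
  then show ?thesis using h(1) by simp
qed

end

text \<open>The two identity homomorphisms give the two inclusions between the i-structures, and
  either one makes the actions agree on their common domain. Extensionality then yields equality of
  the records.\<close>

lemma ialg_eqI:
  fixes A B :: "('o, 'a) ialg"
  assumes A: "is_ialg \<O> A" and B: "is_ialg \<O> B" and carrier: "carrier A = carrier B"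
    and AB: "incl (carrier A) \<in> ihom \<O> A B" and BA: "incl (carrier A) \<in> ihom \<O> B A"
  shows "A = B"
proof -
  have mapA: "map (incl (carrier A)) xs = xs" if "xs \<in> istr A n" for xs n
    using map_incl ialg_istr_tuples(2)[OF A that] by blast
  have mapB: "map (incl (carrier A)) xs = xs" if "xs \<in> istr B n" for xs n
    using map_incl ialg_istr_tuples(2)[OF B that] carrier by metis
  have istr: "istr A n = istr B n" for n
    using ihom_istr[OF AB] ihom_istr[OF BA] mapA mapB by fastforce
  have "act A n = act B n" for n
  proof (rule PiE_ext)
    show "act A n \<in> ops \<O> n \<times> istr A n \<rightarrow>\<^sub>E carrier A" using is_ialgD(2)[OF A] by blast
    show "act B n \<in> ops \<O> n \<times> istr A n \<rightarrow>\<^sub>E carrier A"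
      unfolding istr carrier using is_ialgD(2)[OF B] by blast
    fix p assume "p \<in> ops \<O> n \<times> istr A n"
    then obtain \<sigma> xs where p: "p = (\<sigma>, xs)" "\<sigma> \<in> ops \<O> n" "xs \<in> istr A n" by blast
    then show "act A n p = act B n p"
      using ihom_act[OF AB p(2,3)] mapA[OF p(3)] ialg_act_closed[OF A p(2,3)] by simp
  qed
  then show ?thesis using carrier istr by (intro ialg.equality) auto
qed

text \<open>Uniqueness compares vertices whose carrier is M, so testing over \<open>'a\<close>
  suffices. The second conjunct extends the universal property to test algebras over any type
  \<open>'x\<close>, because the unique cocone is the glued one.\<close>

theorem theorem5p11:
  fixes \<O> :: "'o clone" and M :: "'a set" and \<A> :: "'a set set"
    and D :: "'a set \<Rightarrow> ('o, 'a) ialg" and F :: "'a set \<Rightarrow> 'a set \<Rightarrow> 'a \<Rightarrow> 'a"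
  assumes "is_clone \<O>"
    and "is_atlas \<O> M \<A> D F"
    and "\<A> = {} \<Longrightarrow> ops \<O> 0 = {}"
  shows "(\<exists>!\<mu>. is_colimiting TYPE('a) \<O> \<A> D F \<mu> \<and> U_cocone \<mu> = inclusion_cocone M \<A>) \<and>
         (\<forall>\<mu>. is_colimiting TYPE('a) \<O> \<A> D F \<mu> \<and> U_cocone \<mu> = inclusion_cocone M \<A> \<longrightarrow>
              is_colimiting TYPE('x) \<O> \<A> D F \<mu>)"
proof -
  interpret atlas \<O> M \<A> D F using assms by unfold_locales
  have unique: "\<mu> = glued_cocone"
    if \<mu>: "is_colimiting TYPE('a) \<O> \<A> D F \<mu>" "U_cocone \<mu> = inclusion_cocone M \<A>" for \<mu>
  proof (rule prod_eqI)
    \<comment> \<open>The test type is \<open>'a\<close> because the mediating map goes to the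
      vertex of \<mu>, an algebra over \<open>'a\<close>.\<close>
    note glued = glued_cocone_colimiting[where 'x = 'a] U_glued_cocone
    have cocone: "is_cocone \<O> \<A> D F \<mu>" using \<mu>(1) unfolding is_colimiting_def by blast
    have carrier: "carrier (fst \<mu>) = M" "carrier (fst glued_cocone) = M"
      using \<mu>(2) U_glued_cocone by (simp_all add: U_cocone_def inclusion_cocone_def)
    show "snd \<mu> = snd glued_cocone"
      using \<mu>(2) by (simp add: U_cocone_def inclusion_cocone_def glued_cocone_def)
    show "fst \<mu> = fst glued_cocone"
    proof (rule ialg_eqI)
      show "is_ialg \<O> (fst \<mu>)" by (rule is_coconeD(1)[OF cocone])
      show "is_ialg \<O> (fst glued_cocone)"
        using glued_is_ialg by (simp add: glued_cocone_def)
      show "incl (carrier (fst \<mu>)) \<in> ihom \<O> (fst \<mu>) (fst glued_cocone)"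
        using colimiting_identity_ihom[OF \<mu> glued_cocone_is_cocone U_glued_cocone] carrier by simp
      show "incl (carrier (fst \<mu>)) \<in> ihom \<O> (fst glued_cocone) (fst \<mu>)"
        using colimiting_identity_ihom[OF glued cocone \<mu>(2)] carrier by simp
    qed (simp add: carrier)
  qed
  show ?thesis
  proof (intro conjI allI impI)
    show "\<exists>!\<mu>. is_colimiting TYPE('a) \<O> \<A> D F \<mu> \<and> U_cocone \<mu> = inclusion_cocone M \<A>"
      by (intro ex1I[of _ glued_cocone] conjI glued_cocone_colimiting U_glued_cocone)
        (elim conjE, rule unique)
  next
    fix \<mu> assume "is_colimiting TYPE('a) \<O> \<A> D F \<mu> \<and> U_cocone \<mu> = inclusion_cocone M \<A>"
    then have "\<mu> = glued_cocone" using unique by blast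
    then show "is_colimiting TYPE('x) \<O> \<A> D F \<mu>" using glued_cocone_colimiting by simp
  qed
qed

end
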